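(* In Version B, the $\mathcal{P}$-positions with exactly $3$ (nonempty) piles are precisely the positions of one of the following forms (the order of the piles is irrelevant): \begin{itemize} \item $e_2, e_2, e_2$; \item $e_2, o_1, o_1$. \end{itemize}
   Context: Version B is a two-player impartial game. A position consists of finitely many piles of tokens; empty piles are ignored. The players alternate turns; on a turn, a player either removes a single token from any one nonempty pile, or removes one token from each (nonempty) pile. The last player to move wins. A position is a $\mathcal{P}$-position if the player who is not about to move has a winning strategy, equivalently if none of its options (positions reachable in one move) is a $\mathcal{P}$-position; otherwise it is an $\mathcal{N}$-position. A position is written as the list of its pile sizes. Notation: $e_k$ (respectively $o_k$) denotes any even (respectively odd) pile of size at least $k$; different occurrences of the same symbol in a list may stand for different sizes. *)

theory Defs
  imports "HOL-Library.Multiset"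
begin

(* A position is the multiset of its pile sizes. Size 0 is allowed, so that an exhausted pile may
   stay in the position; "empty piles are ignored" because no move depends on them and because
   piles are counted by nonempty_piles. *)
type_synonym position = "nat multiset"

definition nonempty_piles :: "position \<Rightarrow> nat multiset" where
  "nonempty_piles M = filter_mset (\<lambda>x. 0 < x) M"

inductive move :: "position \<Rightarrow> position \<Rightarrow> bool" where
  single: "x \<in># M \<Longrightarrow> 0 < x \<Longrightarrow> move M (add_mset (x - 1) (M - {#x#}))"
  (* Truncated subtraction leaves the empty piles empty. *)
| all: "nonempty_piles M \<noteq> {#} \<Longrightarrow> move M (image_mset (\<lambda>x. x - 1) M)"

(* Least fixed points, i.e. existence of a winning strategy for the player who is not (P_position),
   respectively who is (N_position), about to move. A position without moves is a P-position, as
   the last player to move wins. *)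
inductive P_position :: "position \<Rightarrow> bool" and N_position :: "position \<Rightarrow> bool" where
  "(\<And>M'. move M M' \<Longrightarrow> N_position M') \<Longrightarrow> P_position M"
| "move M M' \<Longrightarrow> P_position M' \<Longrightarrow> N_position M"

lemma move_sum_less: "move M M' \<Longrightarrow> sum_mset M' < sum_mset M"
proof (induction rule: move.induct)
  case (single x M)
  then obtain L where "M = add_mset x L" by (metis insert_DiffM)
  with single show ?case by simp
next
  case (all M)
  then obtain x where x: "x \<in># M" "0 < x"
    by (auto simp: nonempty_piles_def elim: multiset_nonemptyE)
  then obtain L where "M = add_mset x L" by (metis insert_DiffM)
  moreover have "sum_mset (image_mset (\<lambda>x. x - 1) L) \<le> sum_mset L"
    by (induction L) auto
  ultimately show ?case using x by simp
qed

lemma N_position_iff_not_P_position: "N_position M \<longleftrightarrow> \<not> P_position M"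
proof (induction M rule: measure_induct_rule[where f = sum_mset])
  case (less M)
  then have "N_position M' \<longleftrightarrow> \<not> P_position M'" if "move M M'" for M'
    using move_sum_less that by blast
  then show ?case
    by (metis P_position.cases N_position.cases P_position_N_position.intros)
qed

lemma P_position_iff: "P_position M \<longleftrightarrow> (\<forall>M'. move M M' \<longrightarrow> \<not> P_position M')"
  by (metis N_position_iff_not_P_position P_position.cases P_position_N_position.intros(1))

end

(* With s nonempty piles, d of them odd, a single move changes the parity of d, and the move on all
   piles replaces d by s - d. For s \<le> 3 the P-positions are those with d = 0 or (d, s) = (2, 3):
   none of these reaches another, and every other position has d = 1, where lowering the odd pile
   gives d = 0, or d = s, where the move on all piles gives d = 0. *)
theory Submission
  imports Defs
begin

definition odd_piles :: "position \<Rightarrow> nat multiset" where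
  "odd_piles M = filter_mset odd M"

lemma size_odd_piles_le: "size (odd_piles M) \<le> size (nonempty_piles M)"
  by (induction M) (auto simp: odd_piles_def nonempty_piles_def elim: oddE)

lemma odd_piles_nonempty_piles: "odd_piles (nonempty_piles M) = odd_piles M"
  by (induction M) (auto simp: odd_piles_def nonempty_piles_def elim: oddE)

text \<open>Every nonempty pile changes parity, so it is odd exactly once, either before or after
  the move. An empty pile stays at 0 and counts on neither side.\<close>

lemma size_odd_piles_all:
  "size (odd_piles (image_mset (\<lambda>x. x - 1) M)) + size (odd_piles M) = size (nonempty_piles M)"
  by (induction M) (auto simp: odd_piles_def nonempty_piles_def elim: oddE)

lemma size_nonempty_piles_all_le:
  "size (nonempty_piles (image_mset (\<lambda>x. x - 1) M)) \<le> size (nonempty_piles M)"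
  by (induction M) (auto simp: nonempty_piles_def)

lemma move_size_nonempty_piles_le:
  "move M M' \<Longrightarrow> size (nonempty_piles M') \<le> size (nonempty_piles M)"
proof (induction rule: move.induct)
  case (single x M)
  then obtain L where "M = add_mset x L" by (metis insert_DiffM)
  with single show ?case by (simp add: nonempty_piles_def)
next
  case (all M)
  show ?case by (rule size_nonempty_piles_all_le)
qed

text \<open>Exactly one pile changes parity, so the number of odd piles changes by one.\<close>

lemma even_size_odd_piles_single:
  assumes "x \<in># M" "0 < x"
  shows "even (size (odd_piles (add_mset (x - 1) (M - {#x#})))) \<longleftrightarrow> odd (size (odd_piles M))"
proof -
  obtain L where "M = add_mset x L" using assms by (metis insert_DiffM)
  with assms show ?thesis by (auto simp: odd_piles_def)
qed

text \<open>A move can empty piles, so the induction has to cover fewer than three piles as well.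
  The bound 3 passes to every option because no move creates a nonempty pile.\<close>

lemma P_position_iff_odd_piles:
  assumes "size (nonempty_piles M) \<le> 3"
  shows "P_position M \<longleftrightarrow>
    size (odd_piles M) = 0 \<or> size (odd_piles M) = 2 \<and> size (nonempty_piles M) = 3"
  using assms
proof (induction M rule: measure_induct_rule[where f = sum_mset])
  case (less M)
  define W where "W N \<longleftrightarrow>
    size (odd_piles N) = 0 \<or> size (odd_piles N) = 2 \<and> size (nonempty_piles N) = 3" for N
  have options: "P_position M' \<longleftrightarrow> W M'" if "move M M'" for M'
    using less.IH[OF move_sum_less[OF that]] move_size_nonempty_piles_le[OF that] less.prems
    by (auto simp: W_def)
  have "\<not> W M'" if "move M M'" "W M" for M'
    using that
  proof (cases rule: move.cases)
    case (single x)
    \<comment> \<open>\<open>W\<close> forces an even number of odd piles, and this move makes that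
      number odd.\<close>
    then show ?thesis
      using even_size_odd_piles_single[of x M] \<open>W M\<close> by (auto simp: W_def)
  next
    case all
    then have "0 < size (nonempty_piles M)" by (simp add: nonempty_has_size)
    \<comment> \<open>From 0 odd piles among s > 0, the move leads to s odd piles;
      \<open>W M'\<close> would then need s = 2 but three nonempty piles. From 2 odd piles among 3,
      it leads to a single odd pile.\<close>
    then show ?thesis
      using all(1) \<open>W M\<close> less.prems size_odd_piles_all[of M] size_nonempty_piles_all_le[of M]
      unfolding W_def \<open>M' = _\<close> by linarith
  qed
  moreover have "\<exists>M'. move M M' \<and> W M'" if "\<not> W M"
  proof (cases "size (odd_piles M) = 1")
    case True
    then obtain x where x: "odd_piles M = {#x#}" by (metis size_1_singleton_mset)
    then have "x \<in># odd_piles M" by simp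
    then have "x \<in># M" "odd x" by (auto simp: odd_piles_def)
    then obtain L where L: "M = add_mset x L" by (metis insert_DiffM)
    then have "size (odd_piles (add_mset (x - 1) (M - {#x#}))) = 0"
      using x \<open>odd x\<close> by (auto simp: odd_piles_def)
    then show ?thesis
      using move.single[OF \<open>x \<in># M\<close>] \<open>odd x\<close> unfolding W_def by (metis odd_pos)
  next
    case False
    \<comment> \<open>The counts 0 and 1 are excluded. A count of 2 leaves only two nonempty piles,
      since three would satisfy \<open>W\<close>; a count of 3 reaches the bound.\<close>
    then have eq: "size (odd_piles M) = size (nonempty_piles M)" "0 < size (nonempty_piles M)"
      using \<open>\<not> W M\<close> size_odd_piles_le[of M] less.prems unfolding W_def by linarith+
    then have "size (odd_piles (image_mset (\<lambda>x. x - 1) M)) = 0"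
      using size_odd_piles_all[of M] by linarith
    then show ?thesis
      using move.all eq(2) unfolding W_def by (metis nonempty_has_size)
  qed
  ultimately show ?case
    using options P_position_iff[of M] unfolding W_def by blast
qed

theorem lemma2p3:
  fixes M :: position
  assumes "size (nonempty_piles M) = 3"
  shows "P_position M \<longleftrightarrow>
    (\<exists>a b c. nonempty_piles M = {#a, b, c#} \<and>
      ((even a \<and> a \<ge> 2 \<and> even b \<and> b \<ge> 2 \<and> even c \<and> c \<ge> 2) \<or>
       (even a \<and> a \<ge> 2 \<and> odd b \<and> b \<ge> 1 \<and> odd c \<and> c \<ge> 1)))"
    (is "_ \<longleftrightarrow> ?R")
proof -
  have P: "P_position M \<longleftrightarrow> size (odd_piles M) = 0 \<or> size (odd_piles M) = 2"
    using P_position_iff_odd_piles[of M] assms by simp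
  have odd_piles: "odd_piles M = odd_piles {#a, b, c#}" if "nonempty_piles M = {#a, b, c#}" for a b c
    using odd_piles_nonempty_piles[of M] that by simp
  show ?thesis
  proof
    assume "P_position M"
    obtain a b c where abc: "nonempty_piles M = {#a, b, c#}"
      using assms by (metis numeral_3_eq_3 size_eq_Suc_imp_eq_union size_eq_0_iff_empty size_add_mset nat.inject)
    have "x \<in># nonempty_piles M \<Longrightarrow> 0 < x" for x
      by (simp add: nonempty_piles_def)
    then have pos: "0 < a" "0 < b" "0 < c" by (simp_all add: abc)
    have ge2: "2 \<le> x" if "even x" "0 < x" for x :: nat
      using that by presburger
    \<comment> \<open>The form with two odd piles lists its even pile first, but that pile may be
      \<open>b\<close> or \<open>c\<close>.\<close>
    have perm: "nonempty_piles M = {#b, a, c#}" "nonempty_piles M = {#c, a, b#}"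
      using abc by (simp_all add: add_mset_commute)
    consider "even a" "even b" "even c" | "even a" "odd b" "odd c"
      | "even b" "odd a" "odd c" | "even c" "odd a" "odd b"
      using \<open>P_position M\<close> unfolding P odd_piles[OF abc] by (auto simp: odd_piles_def split: if_splits)
    then show ?R
    proof cases
      case 1 then show ?thesis using abc pos ge2 by blast
    next
      case 2 then show ?thesis using abc pos ge2 by (metis One_nat_def Suc_leI)
    next
      case 3 then show ?thesis using perm(1) pos ge2 by (metis One_nat_def Suc_leI)
    next
      case 4 then show ?thesis using perm(2) pos ge2 by (metis One_nat_def Suc_leI)
    qed
  next
    assume ?R
    then obtain a b c where abc: "nonempty_piles M = {#a, b, c#}"
      and parity: "even a \<and> even b \<and> even c \<or> even a \<and> odd b \<and> odd c"
      by blast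
    show "P_position M"
      using parity unfolding P odd_piles[OF abc] by (auto simp: odd_piles_def)
  qed
qed

end
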